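(* There exists on the operad $\mathbf{V}$ a unique structure of anticyclic operad, given for every $n\ge 0$ by an operator $\theta_{\mathbf{V}}$ on $\mathbf{V}(2n+1)$, such that $\theta_{\mathbf{V}}(g)=-g$.
   Context: One works with graded abelian groups and the Koszul sign rule; morphisms are linear maps preserving the grading. A (nonsymmetric) operad $\mathbf{P}$ is a collection of graded abelian groups $\mathbf{P}(n)=\bigoplus_{k\in\mathbb{Z}}\mathbf{P}(n)_k$, $n\ge 1$, with a unit $\boldsymbol{1}\in\mathbf{P}(1)_0$ (neutral for all compositions) and weight-additive linear maps $\circ_i:\mathbf{P}(m)\otimes\mathbf{P}(n)\to\mathbf{P}(m+n-1)$, $1\le i\le m$, satisfying $(a\circ_i b)\circ_{j+i-1}c=a\circ_i(b\circ_j c)$ and, for $i<j$, $(a\circ_i b)\circ_{j+\#b-1}c=(-1)^{bc}(a\circ_j c)\circ_i b$. For $a\in\mathbf{P}(n)_k$, $\#a=n$ is the degree and $k$ the weight; in exponents of $-1$ the letter $a$ denotes the weight of $a$. Write $a\circ_{\max}b=a\circ_{\#a}b$. An anticyclic structure on $\mathbf{P}$ is a (weight-preserving) linear operator $\theta$ on each $\mathbf{P}(n)$ with $\theta(\boldsymbol{1})=-\boldsymbol{1}$, $\theta^{n+1}=\mathrm{Id}$ on $\mathbf{P}(n)$, $\theta(a\circ_i b)=\theta(a)\circ_{i-1}b$ for $i>1$, and $\theta(a\circ_1 b)=-(-1)^{ab}\theta(b)\circ_{\max}\theta(a)$. The operad $\mathbf{V}$ is presented by one generator $g$ of degree $3$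 and weight $1$ with the single relation $g\circ_1 g-g\circ_2 g+g\circ_3 g=0$ (so it is concentrated in odd degrees $2n+1$, $n\ge0$). *)

theory Defs
  imports "HOL-Algebra.Group"
begin

section \<open>Graded nonsymmetric operads\<close>

text \<open>
  A graded abelian group \<open>P(n)\<close> is given by the family of its homogeneous pieces \<open>P(n)\<^sub>k\<close>,
  indexed by the weight; a linear map preserving the grading is a family of homomorphisms between
  the pieces, and a weight-additive bilinear map is a family of bimorphisms between them.  The pieces
  are HOL-Algebra groups, so the sum, zero and negative of \<open>P(n)\<^sub>k\<close> are written
  multiplicatively (\<open>\<otimes>\<close>, \<open>\<one>\<close>, \<open>inv\<close>).

  \<open>circ P m k n l i a b\<close> is \<open>a \<circ>\<^sub>i b\<close> for \<open>a \<in> P(m)\<^sub>k\<close> and \<open>b \<in> P(n)\<^sub>l\<close>; the degrees and weights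
  are arguments because the carriers of distinct pieces need not be disjoint.  Only the values for
  \<open>m, n \<ge> 1\<close>, \<open>1 \<le> i \<le> m\<close> and arguments in the carriers are meaningful.
\<close>

record 'a graded_operad =
  piece :: "nat \<Rightarrow> int \<Rightarrow> 'a monoid"
  op_unit :: 'a
  circ :: "nat \<Rightarrow> int \<Rightarrow> nat \<Rightarrow> int \<Rightarrow> nat \<Rightarrow> 'a \<Rightarrow> 'a \<Rightarrow> 'a"

text \<open>\<open>(-1)\<^sup>e x\<close>, in the abelian group \<open>G\<close> written multiplicatively.\<close>

definition signed :: "('a, 'b) monoid_scheme \<Rightarrow> int \<Rightarrow> 'a \<Rightarrow> 'a" where
  "signed G e x = (if even e then x else inv\<^bsub>G\<^esub> x)"

locale operad =
  fixes P :: "'a graded_operad"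
  assumes piece_comm_group: "n \<ge> 1 \<Longrightarrow> comm_group (piece P n k)"
    and unit_closed: "op_unit P \<in> carrier (piece P 1 0)"
    and circ_hom_left:
      "\<lbrakk>m \<ge> 1; n \<ge> 1; i \<in> {1..m}; b \<in> carrier (piece P n l)\<rbrakk> \<Longrightarrow>
       (\<lambda>a. circ P m k n l i a b) \<in> hom (piece P m k) (piece P (m + n - 1) (k + l))"
    and circ_hom_right:
      "\<lbrakk>m \<ge> 1; n \<ge> 1; i \<in> {1..m}; a \<in> carrier (piece P m k)\<rbrakk> \<Longrightarrow>
       (\<lambda>b. circ P m k n l i a b) \<in> hom (piece P n l) (piece P (m + n - 1) (k + l))"
    and circ_unit_right:
      "\<lbrakk>m \<ge> 1; i \<in> {1..m}; a \<in> carrier (piece P m k)\<rbrakk> \<Longrightarrow> circ P m k 1 0 i a (op_unit P) = a"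
    and circ_unit_left:
      "\<lbrakk>n \<ge> 1; b \<in> carrier (piece P n l)\<rbrakk> \<Longrightarrow> circ P 1 0 n l 1 (op_unit P) b = b"
    and circ_sequential:
      "\<lbrakk>m \<ge> 1; n \<ge> 1; p \<ge> 1; i \<in> {1..m}; j \<in> {1..n};
        a \<in> carrier (piece P m k); b \<in> carrier (piece P n l); c \<in> carrier (piece P p q)\<rbrakk> \<Longrightarrow>
       circ P (m + n - 1) (k + l) p q (j + i - 1) (circ P m k n l i a b) c =
       circ P m k (n + p - 1) (l + q) i a (circ P n l p q j b c)"
    and circ_parallel:
      "\<lbrakk>m \<ge> 1; n \<ge> 1; p \<ge> 1; i \<in> {1..m}; j \<in> {1..m}; i < j;
        a \<in> carrier (piece P m k); b \<in> carrier (piece P n l); c \<in> carrier (piece P p q)\<rbrakk> \<Longrightarrow>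
       circ P (m + n - 1) (k + l) p q (j + n - 1) (circ P m k n l i a b) c =
       signed (piece P (m + n + p - 2) (k + l + q)) (l * q)
         (circ P (m + p - 1) (k + q) n l i (circ P m k p q j a c) b)"

locale anticyclic_operad = operad P for P :: "'a graded_operad" +
  fixes \<theta> :: "nat \<Rightarrow> int \<Rightarrow> 'a \<Rightarrow> 'a"
  assumes theta_hom: "n \<ge> 1 \<Longrightarrow> \<theta> n k \<in> hom (piece P n k) (piece P n k)"
    and theta_unit: "\<theta> 1 0 (op_unit P) = inv\<^bsub>piece P 1 0\<^esub> (op_unit P)"
    and theta_order: "\<lbrakk>n \<ge> 1; a \<in> carrier (piece P n k)\<rbrakk> \<Longrightarrow> (\<theta> n k ^^ (n + 1)) a = a"
    and theta_circ:
      "\<lbrakk>m \<ge> 1; n \<ge> 1; i \<in> {1..m}; i > 1;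
        a \<in> carrier (piece P m k); b \<in> carrier (piece P n l)\<rbrakk> \<Longrightarrow>
       \<theta> (m + n - 1) (k + l) (circ P m k n l i a b) = circ P m k n l (i - 1) (\<theta> m k a) b"
    and theta_circ_1:
      "\<lbrakk>m \<ge> 1; n \<ge> 1; a \<in> carrier (piece P m k); b \<in> carrier (piece P n l)\<rbrakk> \<Longrightarrow>
       \<theta> (m + n - 1) (k + l) (circ P m k n l 1 a b) =
       inv\<^bsub>piece P (m + n - 1) (k + l)\<^esub>
         (signed (piece P (m + n - 1) (k + l)) (k * l)
           (circ P n l m k n (\<theta> n l b) (\<theta> m k a)))"


section \<open>Presentation of an operad by generators and relations\<close>

text \<open>
  The operad presented by homogeneous generators and relations is the set of all well-formed
  expressions in the generators, the unit, the group operations and the partial compositions, modulo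
  the smallest congruence which contains the axioms of an operad and makes every relator zero.  The
  zero expressions carry their degree and weight, so that these are determined by the expression.
  The parameters \<open>dg\<close> and \<open>wg\<close> give the degrees and weights of the generators.
\<close>

datatype 'g expr =
    Gen 'g
  | Unit
  | Zero nat int
  | Neg "'g expr"
  | Add "'g expr" "'g expr"
  | Circ "'g expr" nat "'g expr"

primrec deg :: "('g \<Rightarrow> nat) \<Rightarrow> 'g expr \<Rightarrow> nat" where
  "deg dg (Gen g) = dg g"
| "deg dg Unit = 1"
| "deg dg (Zero n k) = n"
| "deg dg (Neg a) = deg dg a"
| "deg dg (Add a b) = deg dg a"
| "deg dg (Circ a i b) = deg dg a + deg dg b - 1"

primrec wt :: "('g \<Rightarrow> int) \<Rightarrow> 'g expr \<Rightarrow> int" where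
  "wt wg (Gen g) = wg g"
| "wt wg Unit = 0"
| "wt wg (Zero n k) = k"
| "wt wg (Neg a) = wt wg a"
| "wt wg (Add a b) = wt wg a"
| "wt wg (Circ a i b) = wt wg a + wt wg b"

primrec wf_expr :: "('g \<Rightarrow> nat) \<Rightarrow> ('g \<Rightarrow> int) \<Rightarrow> 'g expr \<Rightarrow> bool" where
  "wf_expr dg wg (Gen g) \<longleftrightarrow> dg g \<ge> 1"
| "wf_expr dg wg Unit \<longleftrightarrow> True"
| "wf_expr dg wg (Zero n k) \<longleftrightarrow> n \<ge> 1"
| "wf_expr dg wg (Neg a) \<longleftrightarrow> wf_expr dg wg a"
| "wf_expr dg wg (Add a b) \<longleftrightarrow>
     wf_expr dg wg a \<and> wf_expr dg wg b \<and> deg dg a = deg dg b \<and> wt wg a = wt wg b"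
| "wf_expr dg wg (Circ a i b) \<longleftrightarrow>
     wf_expr dg wg a \<and> wf_expr dg wg b \<and> 1 \<le> i \<and> i \<le> deg dg a"

definition signed_expr :: "int \<Rightarrow> 'g expr \<Rightarrow> 'g expr" where
  "signed_expr e t = (if even e then t else Neg t)"

inductive expr_eq ::
  "('g \<Rightarrow> nat) \<Rightarrow> ('g \<Rightarrow> int) \<Rightarrow> 'g expr set \<Rightarrow> 'g expr \<Rightarrow> 'g expr \<Rightarrow> bool"
  for dg wg R
where
  refl: "wf_expr dg wg a \<Longrightarrow> expr_eq dg wg R a a"
| sym: "expr_eq dg wg R a b \<Longrightarrow> expr_eq dg wg R b a"
| trans: "\<lbrakk>expr_eq dg wg R a b; expr_eq dg wg R b c\<rbrakk> \<Longrightarrow> expr_eq dg wg R a c"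
| neg_cong: "expr_eq dg wg R a a' \<Longrightarrow> expr_eq dg wg R (Neg a) (Neg a')"
| add_cong: "\<lbrakk>expr_eq dg wg R a a'; expr_eq dg wg R b b'; wf_expr dg wg (Add a b)\<rbrakk> \<Longrightarrow>
    expr_eq dg wg R (Add a b) (Add a' b')"
| circ_cong: "\<lbrakk>expr_eq dg wg R a a'; expr_eq dg wg R b b'; wf_expr dg wg (Circ a i b)\<rbrakk> \<Longrightarrow>
    expr_eq dg wg R (Circ a i b) (Circ a' i b')"
| add_assoc: "\<lbrakk>wf_expr dg wg (Add a b); wf_expr dg wg (Add b c)\<rbrakk> \<Longrightarrow>
    expr_eq dg wg R (Add (Add a b) c) (Add a (Add b c))"
| add_comm: "wf_expr dg wg (Add a b) \<Longrightarrow> expr_eq dg wg R (Add a b) (Add b a)"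
| add_zero: "wf_expr dg wg a \<Longrightarrow> expr_eq dg wg R (Add (Zero (deg dg a) (wt wg a)) a) a"
| add_neg: "wf_expr dg wg a \<Longrightarrow> expr_eq dg wg R (Add (Neg a) a) (Zero (deg dg a) (wt wg a))"
| circ_add_left: "\<lbrakk>wf_expr dg wg (Add a a'); wf_expr dg wg (Circ a i b)\<rbrakk> \<Longrightarrow>
    expr_eq dg wg R (Circ (Add a a') i b) (Add (Circ a i b) (Circ a' i b))"
| circ_add_right: "\<lbrakk>wf_expr dg wg (Add b b'); wf_expr dg wg (Circ a i b)\<rbrakk> \<Longrightarrow>
    expr_eq dg wg R (Circ a i (Add b b')) (Add (Circ a i b) (Circ a i b'))"
| unit_right: "wf_expr dg wg (Circ a i Unit) \<Longrightarrow> expr_eq dg wg R (Circ a i Unit) a"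
| unit_left: "wf_expr dg wg b \<Longrightarrow> expr_eq dg wg R (Circ Unit 1 b) b"
| sequential: "\<lbrakk>wf_expr dg wg (Circ a i b); wf_expr dg wg (Circ b j c)\<rbrakk> \<Longrightarrow>
    expr_eq dg wg R (Circ (Circ a i b) (j + i - 1) c) (Circ a i (Circ b j c))"
| parallel: "\<lbrakk>wf_expr dg wg (Circ a i b); wf_expr dg wg (Circ a j c); i < j\<rbrakk> \<Longrightarrow>
    expr_eq dg wg R (Circ (Circ a i b) (j + deg dg b - 1) c)
      (signed_expr (wt wg b * wt wg c) (Circ (Circ a j c) i b))"
| relator: "\<lbrakk>r \<in> R; wf_expr dg wg r\<rbrakk> \<Longrightarrow> expr_eq dg wg R r (Zero (deg dg r) (wt wg r))"

definition expr_rel ::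
  "('g \<Rightarrow> nat) \<Rightarrow> ('g \<Rightarrow> int) \<Rightarrow> 'g expr set \<Rightarrow> ('g expr \<times> 'g expr) set" where
  "expr_rel dg wg R = {(a, b). expr_eq dg wg R a b}"

definition expr_class ::
  "('g \<Rightarrow> nat) \<Rightarrow> ('g \<Rightarrow> int) \<Rightarrow> 'g expr set \<Rightarrow> 'g expr \<Rightarrow> 'g expr set" where
  "expr_class dg wg R a = expr_rel dg wg R `` {a}"

definition presented_operad ::
  "('g \<Rightarrow> nat) \<Rightarrow> ('g \<Rightarrow> int) \<Rightarrow> 'g expr set \<Rightarrow> 'g expr set graded_operad" where
  "presented_operad dg wg R =
    \<lparr>piece = (\<lambda>n k.
       \<lparr>carrier = {a. wf_expr dg wg a \<and> deg dg a = n \<and> wt wg a = k} // expr_rel dg wg R,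
        mult = (\<lambda>X Y. \<Union>a\<in>X. \<Union>b\<in>Y. expr_class dg wg R (Add a b)),
        one = expr_class dg wg R (Zero n k)\<rparr>),
     op_unit = expr_class dg wg R Unit,
     circ = (\<lambda>m k n l i X Y. \<Union>a\<in>X. \<Union>b\<in>Y. expr_class dg wg R (Circ a i b))\<rparr>"


subsection \<open>The presented operad is an operad\<close>

lemma deg_pos: "wf_expr dg wg a \<Longrightarrow> deg dg a \<ge> 1"
  by (induction a) auto

lemma expr_eq_wf:
  assumes "expr_eq dg wg R a b"
  shows "wf_expr dg wg a \<and> wf_expr dg wg b \<and> deg dg a = deg dg b \<and> wt wg a = wt wg b"
  using assms
proof (induction rule: expr_eq.induct)
  case (sequential a i b j c)
  then show ?case using deg_pos[of dg wg a] deg_pos[of dg wg b] deg_pos[of dg wg c] by auto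
next
  case (parallel a i b j c)
  then show ?case using deg_pos[of dg wg a] deg_pos[of dg wg b] deg_pos[of dg wg c]
    by (auto simp: signed_expr_def)
qed (auto dest: deg_pos)

lemma expr_class_eq_iff:
  assumes "wf_expr dg wg a"
  shows "expr_class dg wg R a = expr_class dg wg R b \<longleftrightarrow> expr_eq dg wg R a b"
  using assms unfolding expr_class_def expr_rel_def
  by (auto intro: expr_eq.refl expr_eq.sym expr_eq.trans)

lemma expr_class_eqI: "expr_eq dg wg R a b \<Longrightarrow> expr_class dg wg R a = expr_class dg wg R b"
  using expr_class_eq_iff expr_eq_wf by metis

lemma self_in_expr_class: "wf_expr dg wg a \<Longrightarrow> a \<in> expr_class dg wg R a"
  unfolding expr_class_def expr_rel_def by (auto intro: expr_eq.refl)

lemma in_expr_class: "b \<in> expr_class dg wg R a \<longleftrightarrow> expr_eq dg wg R a b"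
  unfolding expr_class_def expr_rel_def by auto

lemma carrier_presented:
  "carrier (piece (presented_operad dg wg R) n k) =
     expr_class dg wg R ` {a. wf_expr dg wg a \<and> deg dg a = n \<and> wt wg a = k}"
  unfolding presented_operad_def quotient_def expr_class_def by auto

lemma one_presented:
  "\<one>\<^bsub>piece (presented_operad dg wg R) n k\<^esub> = expr_class dg wg R (Zero n k)"
  by (simp add: presented_operad_def)

lemma unit_presented: "op_unit (presented_operad dg wg R) = expr_class dg wg R Unit"
  by (simp add: presented_operad_def)

lemma mult_presented:
  assumes "wf_expr dg wg (Add a b)"
  shows "expr_class dg wg R a \<otimes>\<^bsub>piece (presented_operad dg wg R) n k\<^esub> expr_class dg wg R b =
    expr_class dg wg R (Add a b)"
proof -
  have "(\<Union>a'\<in>expr_class dg wg R a. \<Union>b'\<in>expr_class dg wg R b. expr_class dg wg R (Add a' b')) =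
      (\<Union>a'\<in>expr_class dg wg R a. \<Union>b'\<in>expr_class dg wg R b. expr_class dg wg R (Add a b))"
    using assms unfolding in_expr_class
    by (intro SUP_cong HOL.refl expr_class_eqI[symmetric] expr_eq.add_cong) (auto simp: in_expr_class)
  moreover have "expr_class dg wg R a \<noteq> {}" "expr_class dg wg R b \<noteq> {}"
    using assms by (auto dest: self_in_expr_class[where R=R])
  ultimately show ?thesis unfolding presented_operad_def by simp
qed

lemma circ_presented:
  assumes "wf_expr dg wg (Circ a i b)"
  shows "circ (presented_operad dg wg R) m k n l i (expr_class dg wg R a) (expr_class dg wg R b) =
    expr_class dg wg R (Circ a i b)"
proof -
  have "(\<Union>a'\<in>expr_class dg wg R a. \<Union>b'\<in>expr_class dg wg R b. expr_class dg wg R (Circ a' i b')) =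
      (\<Union>a'\<in>expr_class dg wg R a. \<Union>b'\<in>expr_class dg wg R b. expr_class dg wg R (Circ a i b))"
    using assms unfolding in_expr_class
    by (intro SUP_cong HOL.refl expr_class_eqI[symmetric] expr_eq.circ_cong) (auto simp: in_expr_class)
  moreover have "expr_class dg wg R a \<noteq> {}" "expr_class dg wg R b \<noteq> {}"
    using assms by (auto dest: self_in_expr_class[where R=R])
  ultimately show ?thesis unfolding presented_operad_def by simp
qed

lemma comm_group_presented:
  assumes "n \<ge> 1"
  shows "comm_group (piece (presented_operad dg wg R) n k)"
proof (rule comm_groupI)
  let ?G = "piece (presented_operad dg wg R) n k"
  let ?c = "expr_class dg wg R"
  fix x y z
  assume "x \<in> carrier ?G"
  then obtain a where a: "x = ?c a" "wf_expr dg wg a" "deg dg a = n" "wt wg a = k"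
    unfolding carrier_presented by auto
  show "\<one>\<^bsub>?G\<^esub> \<otimes>\<^bsub>?G\<^esub> x = x"
    using a assms expr_eq.add_zero[of dg wg a R]
    by (simp add: one_presented mult_presented expr_class_eq_iff)
  have "?c (Neg a) \<otimes>\<^bsub>?G\<^esub> x = \<one>\<^bsub>?G\<^esub>"
    using a assms expr_eq.add_neg[of dg wg a R]
    by (simp add: one_presented mult_presented expr_class_eq_iff)
  moreover have "?c (Neg a) \<in> carrier ?G" using a unfolding carrier_presented by auto
  ultimately show "\<exists>y\<in>carrier ?G. y \<otimes>\<^bsub>?G\<^esub> x = \<one>\<^bsub>?G\<^esub>" by blast
  assume "y \<in> carrier ?G"
  then obtain b where b: "y = ?c b" "wf_expr dg wg b" "deg dg b = n" "wt wg b = k"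
    unfolding carrier_presented by auto
  show "x \<otimes>\<^bsub>?G\<^esub> y \<in> carrier ?G"
    using a b by (auto simp: mult_presented carrier_presented)
  show "x \<otimes>\<^bsub>?G\<^esub> y = y \<otimes>\<^bsub>?G\<^esub> x"
    using a b by (simp add: mult_presented expr_class_eq_iff expr_eq.add_comm)
  assume "z \<in> carrier ?G"
  then obtain c where c: "z = ?c c" "wf_expr dg wg c" "deg dg c = n" "wt wg c = k"
    unfolding carrier_presented by auto
  show "x \<otimes>\<^bsub>?G\<^esub> y \<otimes>\<^bsub>?G\<^esub> z = x \<otimes>\<^bsub>?G\<^esub> (y \<otimes>\<^bsub>?G\<^esub> z)"
    using a b c by (simp add: mult_presented expr_class_eq_iff expr_eq.add_assoc)
next
  show "\<one>\<^bsub>piece (presented_operad dg wg R) n k\<^esub> \<in> carrier (piece (presented_operad dg wg R) n k)"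
    using assms by (auto simp: one_presented carrier_presented)
qed

lemma inv_presented:
  assumes "wf_expr dg wg a" "deg dg a = n" "wt wg a = k"
  shows "inv\<^bsub>piece (presented_operad dg wg R) n k\<^esub> (expr_class dg wg R a) = expr_class dg wg R (Neg a)"
proof -
  have "n \<ge> 1" using assms deg_pos by auto
  then interpret comm_group "piece (presented_operad dg wg R) n k"
    by (rule comm_group_presented)
  show ?thesis
  proof (rule inv_equality)
    show "expr_class dg wg R (Neg a) \<otimes>\<^bsub>piece (presented_operad dg wg R) n k\<^esub> expr_class dg wg R a =
      \<one>\<^bsub>piece (presented_operad dg wg R) n k\<^esub>"
      using assms expr_eq.add_neg[of dg wg a R]
      by (simp add: one_presented mult_presented expr_class_eq_iff)
  qed (use assms in \<open>auto simp: carrier_presented\<close>)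
qed

lemma signed_presented:
  assumes "wf_expr dg wg a" "deg dg a = n" "wt wg a = k"
  shows "signed (piece (presented_operad dg wg R) n k) e (expr_class dg wg R a) =
    expr_class dg wg R (signed_expr e a)"
  using assms by (simp add: signed_def signed_expr_def inv_presented)

theorem operad_presented: "operad (presented_operad dg wg R)"
proof (rule operad.intro)
  let ?P = "presented_operad dg wg R"
  let ?c = "expr_class dg wg R"
  show "comm_group (piece ?P n k)" if "n \<ge> 1" for n k
    using that by (rule comm_group_presented)
  show "op_unit ?P \<in> carrier (piece ?P 1 0)"
    by (auto simp: unit_presented carrier_presented)
  show "(\<lambda>a. circ ?P m k n l i a b) \<in> hom (piece ?P m k) (piece ?P (m + n - 1) (k + l))"
    if "i \<in> {1..m}" "b \<in> carrier (piece ?P n l)" for m n i b k l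
    using that
    by (auto simp: hom_def carrier_presented circ_presented mult_presented
        expr_class_eqI[OF expr_eq.circ_add_left])
  show "(\<lambda>b. circ ?P m k n l i a b) \<in> hom (piece ?P n l) (piece ?P (m + n - 1) (k + l))"
    if "i \<in> {1..m}" "a \<in> carrier (piece ?P m k)" for m n i a k l
    using that
    by (auto simp: hom_def carrier_presented circ_presented mult_presented
        expr_class_eqI[OF expr_eq.circ_add_right])
  show "circ ?P m k 1 0 i a (op_unit ?P) = a"
    if "i \<in> {1..m}" "a \<in> carrier (piece ?P m k)" for m i a k
    using that
    by (auto simp: unit_presented carrier_presented circ_presented
        expr_class_eqI[OF expr_eq.unit_right])
  show "circ ?P 1 0 n l 1 (op_unit ?P) b = b"
    if "b \<in> carrier (piece ?P n l)" for n l b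
    using that
    by (auto simp: unit_presented carrier_presented circ_presented
        expr_class_eqI[OF expr_eq.unit_left[unfolded One_nat_def]])
  show "circ ?P (m + n - 1) (k + l) p q (j + i - 1) (circ ?P m k n l i a b) c =
       circ ?P m k (n + p - 1) (l + q) i a (circ ?P n l p q j b c)"
    if h: "i \<in> {1..m}" "j \<in> {1..n}" "a \<in> carrier (piece ?P m k)"
      "b \<in> carrier (piece ?P n l)" "c \<in> carrier (piece ?P p q)" for m n p i j a b c k l q
  proof -
    obtain a' b' c' where "a = ?c a'" "b = ?c b'" "c = ?c c'"
      "wf_expr dg wg a'" "deg dg a' = m" "wf_expr dg wg b'" "deg dg b' = n" "wf_expr dg wg c'"
      using h unfolding carrier_presented by auto
    moreover from this have
      "wf_expr dg wg (Circ a' i b')" "wf_expr dg wg (Circ b' j c')"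
      "wf_expr dg wg (Circ (Circ a' i b') (j + i - 1) c')" "wf_expr dg wg (Circ a' i (Circ b' j c'))"
      using h(1,2) by auto
    ultimately show ?thesis
      using expr_class_eqI[OF expr_eq.sequential[of dg wg a' i b' j c' R]]
      by (simp only: circ_presented)
  qed
  show "circ ?P (m + n - 1) (k + l) p q (j + n - 1) (circ ?P m k n l i a b) c =
       signed (piece ?P (m + n + p - 2) (k + l + q)) (l * q)
         (circ ?P (m + p - 1) (k + q) n l i (circ ?P m k p q j a c) b)"
    if h: "i \<in> {1..m}" "j \<in> {1..m}" "i < j" "a \<in> carrier (piece ?P m k)"
      "b \<in> carrier (piece ?P n l)" "c \<in> carrier (piece ?P p q)" for m n p i j a b c k l q
  proof -
    obtain a' b' c' where e: "a = ?c a'" "b = ?c b'" "c = ?c c'"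
      "wf_expr dg wg a'" "deg dg a' = m" "wt wg a' = k"
      "wf_expr dg wg b'" "deg dg b' = n" "wt wg b' = l"
      "wf_expr dg wg c'" "deg dg c' = p" "wt wg c' = q"
      using h unfolding carrier_presented by auto
    have pos: "m \<ge> 1" "n \<ge> 1" "p \<ge> 1" using e deg_pos by auto
    have w: "wf_expr dg wg (Circ (Circ a' j c') i b')" "wf_expr dg wg (Circ (Circ a' i b') (j + n - 1) c')"
      using e h pos by auto
    show ?thesis
      using e h pos w expr_class_eqI[OF expr_eq.parallel[of dg wg a' i b' j c' R]]
      by (auto simp: circ_presented signed_presented)
  qed
qed


subsection \<open>Its universal property\<close>

definition operad_morphism ::
  "'a graded_operad \<Rightarrow> 'b graded_operad \<Rightarrow> (nat \<Rightarrow> int \<Rightarrow> 'a \<Rightarrow> 'b) \<Rightarrow> bool" where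
  "operad_morphism P Q f \<longleftrightarrow>
    (\<forall>n\<ge>1. \<forall>k. f n k \<in> hom (piece P n k) (piece Q n k)) \<and>
    f 1 0 (op_unit P) = op_unit Q \<and>
    (\<forall>m\<ge>1. \<forall>n\<ge>1. \<forall>k l. \<forall>i\<in>{1..m}. \<forall>a\<in>carrier (piece P m k). \<forall>b\<in>carrier (piece P n l).
      f (m + n - 1) (k + l) (circ P m k n l i a b) = circ Q m k n l i (f m k a) (f n l b))"

primrec expr_value ::
  "('g \<Rightarrow> nat) \<Rightarrow> ('g \<Rightarrow> int) \<Rightarrow> 'a graded_operad \<Rightarrow> ('g \<Rightarrow> 'a) \<Rightarrow> 'g expr \<Rightarrow> 'a" where
  "expr_value dg wg Q x (Gen g) = x g"
| "expr_value dg wg Q x Unit = op_unit Q"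
| "expr_value dg wg Q x (Zero n k) = \<one>\<^bsub>piece Q n k\<^esub>"
| "expr_value dg wg Q x (Neg a) = inv\<^bsub>piece Q (deg dg a) (wt wg a)\<^esub> (expr_value dg wg Q x a)"
| "expr_value dg wg Q x (Add a b) =
     expr_value dg wg Q x a \<otimes>\<^bsub>piece Q (deg dg a) (wt wg a)\<^esub> expr_value dg wg Q x b"
| "expr_value dg wg Q x (Circ a i b) =
     circ Q (deg dg a) (wt wg a) (deg dg b) (wt wg b) i
       (expr_value dg wg Q x a) (expr_value dg wg Q x b)"

lemma piece_group_of_expr:
  assumes "operad Q" "wf_expr dg wg a"
  shows "comm_group (piece Q (deg dg a) (wt wg a))"
  using operad.piece_comm_group[OF assms(1)] deg_pos[OF assms(2)] by blast

lemma expr_value_closed: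
  assumes "operad Q" "\<And>g. x g \<in> carrier (piece Q (dg g) (wg g))" "wf_expr dg wg a"
  shows "expr_value dg wg Q x a \<in> carrier (piece Q (deg dg a) (wt wg a))"
  using assms(3)
proof (induction a)
  case (Zero n k)
  then interpret comm_group "piece Q n k" using operad.piece_comm_group[OF assms(1)] by simp
  show ?case by simp
next
  case (Neg a)
  then interpret comm_group "piece Q (deg dg a) (wt wg a)"
    using piece_group_of_expr[OF assms(1), of dg wg a] by simp
  show ?case using Neg by simp
next
  case (Add a b)
  then interpret comm_group "piece Q (deg dg b) (wt wg b)"
    using piece_group_of_expr[OF assms(1), of dg wg b] by simp
  show ?case using Add by simp
next
  case (Circ a i b)
  then have "deg dg a \<ge> 1" "deg dg b \<ge> 1" "i \<in> {1..deg dg a}" using deg_pos[of dg wg] by auto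
  then show ?case
    using Circ operad.circ_hom_left[OF assms(1), of "deg dg a" "deg dg b" i _ "wt wg b" "wt wg a"]
    by (auto simp: hom_def)
qed (use assms operad.unit_closed in auto)

lemma expr_value_cong:
  assumes Q: "operad Q" and x: "\<And>g. x g \<in> carrier (piece Q (dg g) (wg g))"
    and R: "\<And>r. \<lbrakk>r \<in> R; wf_expr dg wg r\<rbrakk> \<Longrightarrow> expr_value dg wg Q x r = \<one>\<^bsub>piece Q (deg dg r) (wt wg r)\<^esub>"
    and "expr_eq dg wg R a b"
  shows "expr_value dg wg Q x a = expr_value dg wg Q x b"
  using assms(4)
proof (induction rule: expr_eq.induct)
  note cl = expr_value_closed[where x=x and dg=dg and wg=wg, OF Q x]
  note grp = piece_group_of_expr[OF Q]
  {
    case (neg_cong a a')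
    then show ?case using expr_eq_wf[of dg wg R a a'] by simp
  next
    case (add_cong a a' b b')
    then show ?case using expr_eq_wf[of dg wg R a a'] by simp
  next
    case (circ_cong a a' b b' i)
    then show ?case using expr_eq_wf[of dg wg R a a'] expr_eq_wf[of dg wg R b b'] by simp
  next
    case (add_assoc a b c)
    then interpret comm_group "piece Q (deg dg c) (wt wg c)"
      using grp[of _ _ c] by simp
    show ?case using add_assoc cl[of a] cl[of b] cl[of c] by (simp add: m_assoc)
  next
    case (add_comm a b)
    then interpret comm_group "piece Q (deg dg b) (wt wg b)"
      using grp[of _ _ b] by simp
    show ?case using add_comm cl[of a] cl[of b] by (simp add: m_comm)
  next
    case (add_zero a)
    then interpret comm_group "piece Q (deg dg a) (wt wg a)"
      using grp[of _ _ a] by simp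
    show ?case using add_zero cl[of a] by simp
  next
    case (add_neg a)
    then interpret comm_group "piece Q (deg dg a) (wt wg a)"
      using grp[of _ _ a] by simp
    show ?case using add_neg cl[of a] by simp
  next
    case (circ_add_left a a' i b)
    then show ?case
      using cl[of a] cl[of a'] cl[of b] deg_pos[of dg wg a] deg_pos[of dg wg b]
        operad.circ_hom_left[OF Q, of "deg dg a" "deg dg b" i _ "wt wg b" "wt wg a"]
      by (auto simp: hom_def)
  next
    case (circ_add_right b b' a i)
    then show ?case
      using cl[of a] cl[of b'] cl[of b] deg_pos[of dg wg a] deg_pos[of dg wg b]
        operad.circ_hom_right[OF Q, of "deg dg a" "deg dg b" i _ "wt wg a" "wt wg b"]
      by (auto simp: hom_def)
  next
    case (unit_right a i)
    then show ?case using cl[of a] operad.circ_unit_right[OF Q] deg_pos[of dg wg a] by auto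
  next
    case (unit_left b)
    then show ?case using cl[of b] operad.circ_unit_left[OF Q] deg_pos[of dg wg b] by auto
  next
    case (sequential a i b j c)
    then show ?case
      using cl[of a] cl[of b] cl[of c] deg_pos[of dg wg a] deg_pos[of dg wg b] deg_pos[of dg wg c]
        operad.circ_sequential[OF Q, of "deg dg a" "deg dg b" "deg dg c" i j
          "expr_value dg wg Q x a" "wt wg a" "expr_value dg wg Q x b" "wt wg b"
          "expr_value dg wg Q x c" "wt wg c"]
      by auto
  next
    case (parallel a i b j c)
    let ?e = "Circ (Circ a j c) i b"
    have pos: "deg dg a \<ge> 1" "deg dg b \<ge> 1" "deg dg c \<ge> 1"
      using parallel deg_pos[of dg wg a] deg_pos[of dg wg b] deg_pos[of dg wg c] by auto
    have d: "deg dg a + deg dg b + deg dg c - 2 = deg dg ?e"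
      "wt wg a + wt wg b + wt wg c = wt wg ?e"
      using pos by auto
    have "expr_value dg wg Q x (Circ (Circ a i b) (j + deg dg b - 1) c) =
      signed (piece Q (deg dg ?e) (wt wg ?e)) (wt wg b * wt wg c) (expr_value dg wg Q x ?e)"
      using parallel pos cl[of a] cl[of b] cl[of c]
        operad.circ_parallel[OF Q, of "deg dg a" "deg dg b" "deg dg c" i j
          "expr_value dg wg Q x a" "wt wg a" "expr_value dg wg Q x b" "wt wg b"
          "expr_value dg wg Q x c" "wt wg c"]
      unfolding d by auto
    then show ?case by (simp add: signed_def signed_expr_def)
  next
    case (relator r)
    then show ?case using R by simp
  }
qed auto

text \<open>
  An assignment of homogeneous elements of an operad \<open>Q\<close> to the generators which satisfies the
  relations extends to a unique morphism from the presented operad to \<open>Q\<close>.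
\<close>

theorem presented_operad_universal:
  fixes Q :: "'a graded_operad" and x :: "'g \<Rightarrow> 'a"
  assumes Q: "operad Q" and dg: "\<And>g. dg g \<ge> 1"
    and x: "\<And>g. x g \<in> carrier (piece Q (dg g) (wg g))"
    and R: "\<And>r. \<lbrakk>r \<in> R; wf_expr dg wg r\<rbrakk> \<Longrightarrow> expr_value dg wg Q x r = \<one>\<^bsub>piece Q (deg dg r) (wt wg r)\<^esub>"
  shows "\<exists>f. operad_morphism (presented_operad dg wg R) Q f \<and>
      (\<forall>g. f (dg g) (wg g) (expr_class dg wg R (Gen g)) = x g) \<and>
      (\<forall>f'. operad_morphism (presented_operad dg wg R) Q f' \<and>
          (\<forall>g. f' (dg g) (wg g) (expr_class dg wg R (Gen g)) = x g) \<longrightarrow>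
        (\<forall>n\<ge>1. \<forall>k. \<forall>X\<in>carrier (piece (presented_operad dg wg R) n k). f' n k X = f n k X))"
proof -
  let ?P = "presented_operad dg wg R"
  let ?c = "expr_class dg wg R"
  let ?v = "expr_value dg wg Q x"
  define f where "f n k X = ?v (SOME a. a \<in> X)" for n :: nat and k :: int and X :: "'g expr set"
  have f: "f n k (?c a) = ?v a" if "wf_expr dg wg a" for n k a
  proof -
    have "(SOME b. b \<in> ?c a) \<in> ?c a" using self_in_expr_class[OF that] by (rule someI)
    then have "expr_eq dg wg R a (SOME b. b \<in> ?c a)" by (simp add: in_expr_class)
    from expr_value_cong[where x=x, OF Q x R this] show ?thesis unfolding f_def by simp
  qed
  note cl = expr_value_closed[where x=x and dg=dg and wg=wg, OF Q x]
  have 1: "operad_morphism ?P Q f"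
    unfolding operad_morphism_def
    by (auto simp: hom_def carrier_presented unit_presented mult_presented circ_presented f cl)
  have 2: "f (dg g) (wg g) (?c (Gen g)) = x g" for g
    using dg by (simp add: f)
  have 3: "f' (deg dg a) (wt wg a) (?c a) = f (deg dg a) (wt wg a) (?c a)"
    if m: "operad_morphism ?P Q f'" and g: "\<And>g. f' (dg g) (wg g) (?c (Gen g)) = x g"
      and a: "wf_expr dg wg a" for f' a
    using a
  proof (induction a)
    case (Gen g)
    then show ?case using g 2 by simp
  next
    case Unit
    then show ?case using m 1 unfolding operad_morphism_def unit_presented by simp
  next
    case (Zero n k)
    then have grp: "group (piece ?P n k)" "group (piece Q n k)"
      using comm_group_presented[of n dg wg R k] operad.piece_comm_group[OF Q, of n k]
      by (simp_all add: comm_group_def)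
    have h: "f' n k \<in> hom (piece ?P n k) (piece Q n k)"
      using Zero m unfolding operad_morphism_def by simp
    show ?case using hom_one[OF h grp] f[OF Zero] by (simp add: one_presented)
  next
    case (Neg a)
    let ?n = "deg dg a" and ?k = "wt wg a"
    have n: "?n \<ge> 1" using Neg deg_pos by simp
    have "group_hom (piece ?P ?n ?k) (piece Q ?n ?k) (f' ?n ?k)"
      using n m comm_group_presented[of ?n dg wg R ?k] operad.piece_comm_group[OF Q, of ?n ?k]
      unfolding operad_morphism_def group_hom_def group_hom_axioms_def comm_group_def by simp
    then have "f' ?n ?k (inv\<^bsub>piece ?P ?n ?k\<^esub> (?c a)) = inv\<^bsub>piece Q ?n ?k\<^esub> (f' ?n ?k (?c a))"
      using Neg by (intro group_hom.hom_inv) (auto simp: carrier_presented)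
    then show ?case using Neg by (simp add: inv_presented f)
  next
    case (Add a b)
    let ?n = "deg dg a" and ?k = "wt wg a"
    have n: "?n \<ge> 1" using Add deg_pos[of dg wg b] by simp
    have "f' ?n ?k \<in> hom (piece ?P ?n ?k) (piece Q ?n ?k)"
      using n m unfolding operad_morphism_def by simp
    moreover have "?c a \<in> carrier (piece ?P ?n ?k)" "?c b \<in> carrier (piece ?P ?n ?k)"
      using Add by (auto simp: carrier_presented)
    ultimately have "f' ?n ?k (?c a \<otimes>\<^bsub>piece ?P ?n ?k\<^esub> ?c b) =
        f' ?n ?k (?c a) \<otimes>\<^bsub>piece Q ?n ?k\<^esub> f' ?n ?k (?c b)"
      by (auto simp: hom_def)
    then show ?case using Add by (simp add: mult_presented f)
  next
    case (Circ a i b)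
    let ?m = "deg dg a" and ?k = "wt wg a" and ?n = "deg dg b" and ?l = "wt wg b"
    have w: "wf_expr dg wg a" "wf_expr dg wg b" "i \<in> {1..?m}" using Circ.prems by auto
    have "?c a \<in> carrier (piece ?P ?m ?k)" "?c b \<in> carrier (piece ?P ?n ?l)"
      using w by (auto simp: carrier_presented)
    then have "f' (?m + ?n - 1) (?k + ?l) (circ ?P ?m ?k ?n ?l i (?c a) (?c b)) =
        circ Q ?m ?k ?n ?l i (f' ?m ?k (?c a)) (f' ?n ?l (?c b))"
      using m w deg_pos[OF w(1)] deg_pos[OF w(2)] unfolding operad_morphism_def by blast
    then show ?case using Circ w by (simp add: circ_presented f)
  qed
  have "f' n k y = f n k y"
    if "operad_morphism ?P Q f'" "\<And>g. f' (dg g) (wg g) (?c (Gen g)) = x g"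
      "y \<in> carrier (piece ?P n k)" for f' n k y
    using that 3[of f'] unfolding carrier_presented by auto
  then show ?thesis using 1 2 by blast
qed


section \<open>The operad \<open>V\<close>\<close>

abbreviation V_deg :: "unit \<Rightarrow> nat" where "V_deg \<equiv> \<lambda>_. 3"

abbreviation V_wt :: "unit \<Rightarrow> int" where "V_wt \<equiv> \<lambda>_. 1"

text \<open>\<open>g \<circ>\<^sub>1 g - g \<circ>\<^sub>2 g + g \<circ>\<^sub>3 g\<close>\<close>

definition V_relator :: "unit expr" where
  "V_relator =
    Add (Add (Circ (Gen ()) 1 (Gen ())) (Neg (Circ (Gen ()) 2 (Gen ())))) (Circ (Gen ()) 3 (Gen ()))"

definition V_operad :: "unit expr set graded_operad" where
  "V_operad = presented_operad V_deg V_wt {V_relator}"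

definition V_gen :: "unit expr set" where
  "V_gen = expr_class V_deg V_wt {V_relator} (Gen ())"

lemma V_gen_closed: "V_gen \<in> carrier (piece V_operad 3 1)"
  unfolding V_gen_def V_operad_def carrier_presented by auto

lemma V_gen_relation:
  "circ V_operad 3 1 3 1 1 V_gen V_gen \<otimes>\<^bsub>piece V_operad 5 2\<^esub>
   inv\<^bsub>piece V_operad 5 2\<^esub> (circ V_operad 3 1 3 1 2 V_gen V_gen) \<otimes>\<^bsub>piece V_operad 5 2\<^esub>
   circ V_operad 3 1 3 1 3 V_gen V_gen = \<one>\<^bsub>piece V_operad 5 2\<^esub>"
  using expr_eq.relator[of V_relator "{V_relator}" V_deg V_wt]
  unfolding V_operad_def V_gen_def
  by (simp add: circ_presented inv_presented mult_presented one_presented expr_class_eq_iff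
      V_relator_def)

text \<open>\<open>V(n)\<^sub>k\<close> vanishes unless \<open>n = 2k + 1\<close>; in particular \<open>V\<close> is concentrated in odd degrees.\<close>

theorem V_concentrated:
  assumes "n \<ge> 1" "int n \<noteq> 2 * k + 1"
  shows "carrier (piece V_operad n k) = {\<one>\<^bsub>piece V_operad n k\<^esub>}"
proof -
  let ?P = "presented_operad V_deg V_wt {V_relator}"
  let ?c = "expr_class V_deg V_wt {V_relator}"
  interpret P: operad ?P by (rule operad_presented)
  have "?c a = \<one>\<^bsub>piece ?P (deg V_deg a) (wt V_wt a)\<^esub>"
    if "wf_expr V_deg V_wt a" "int (deg V_deg a) \<noteq> 2 * wt V_wt a + 1" for a
    using that
  proof (induction a)
    case (Zero n k)
    then show ?case by (simp add: one_presented)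
  next
    case (Neg a)
    interpret comm_group "piece ?P (deg V_deg a) (wt V_wt a)"
      using Neg deg_pos by (intro P.piece_comm_group) auto
    show ?case
      using Neg inv_presented[of V_deg V_wt a "deg V_deg a" "wt V_wt a" "{V_relator}"] by simp
  next
    case (Add a b)
    interpret comm_group "piece ?P (deg V_deg b) (wt V_wt b)"
      using Add deg_pos by (intro P.piece_comm_group) auto
    show ?case
      using Add mult_presented[of V_deg V_wt a b "{V_relator}" "deg V_deg a" "wt V_wt a"] by simp
  next
    case (Circ a i b)
    let ?m = "deg V_deg a" and ?k = "wt V_wt a" and ?n = "deg V_deg b" and ?l = "wt V_wt b"
    have w: "wf_expr V_deg V_wt a" "wf_expr V_deg V_wt b" "i \<in> {1..?m}" using Circ.prems by auto
    have pos: "?m \<ge> 1" "?n \<ge> 1" "?m + ?n - 1 \<ge> 1" using deg_pos[OF w(1)] deg_pos[OF w(2)] by auto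
    have cl: "?c a \<in> carrier (piece ?P ?m ?k)" "?c b \<in> carrier (piece ?P ?n ?l)"
      using w by (auto simp: carrier_presented)
    have grp: "group (piece ?P ?m ?k)" "group (piece ?P ?n ?l)"
        "group (piece ?P (?m + ?n - 1) (?k + ?l))"
      using P.piece_comm_group pos unfolding comm_group_def by blast+
    have "int ?m \<noteq> 2 * ?k + 1 \<or> int ?n \<noteq> 2 * ?l + 1" using Circ.prems pos by auto
    then have "circ ?P ?m ?k ?n ?l i (?c a) (?c b) = \<one>\<^bsub>piece ?P (?m + ?n - 1) (?k + ?l)\<^esub>"
    proof
      assume "int ?m \<noteq> 2 * ?k + 1"
      then show ?thesis
        using Circ.IH(1) w hom_one[OF P.circ_hom_left[OF pos(1,2) w(3) cl(2)] grp(1,3)] by simp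
    next
      assume "int ?n \<noteq> 2 * ?l + 1"
      then show ?thesis
        using Circ.IH(2) w hom_one[OF P.circ_hom_right[OF pos(1,2) w(3) cl(1)] grp(2,3)] by simp
    qed
    then show ?case using Circ.prems by (simp add: circ_presented)
  qed auto
  moreover have "\<one>\<^bsub>piece ?P n k\<^esub> \<in> carrier (piece ?P n k)"
    using assms(1) by (auto simp: one_presented carrier_presented)
  ultimately show ?thesis using assms(2) unfolding V_operad_def
    by (force simp: carrier_presented)
qed

end

theory Submission
  imports Defs
begin

text \<open>
  The axioms of an anticyclic operad prescribe \<open>\<theta>\<close> on \<open>a \<circ>\<^sub>i b\<close> in terms of \<open>\<theta>(a)\<close> and \<open>\<theta>(b)\<close>, so
  \<open>\<theta>\<close> is determined by its values on generators.  Conversely, these rules define an operator on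
  formal expressions.  It maps each operad axiom to a consequence of the operad axioms (the parallel
  axiom with \<open>i = 1\<close> becomes a sequential one, and the sequential axiom with \<open>i = 1 < j\<close> a parallel
  one), hence descends to the quotient as soon as it preserves the relations.  With \<open>n = #b\<close> one
  finds \<open>\<theta>\<^sup>i\<^sup>+\<^sup>n(a \<circ>\<^sub>i b) = \<theta>\<^sup>i\<^sup>+\<^sup>1(a) \<circ>\<^sub>m\<^sub>a\<^sub>x \<theta>\<^sup>n\<^sup>+\<^sup>1(b)\<close>, so the condition on the order of \<open>\<theta>\<close> passes
  from \<open>a\<close> and \<open>b\<close> to \<open>a \<circ>\<^sub>i b\<close>.  For \<open>V\<close>, the operator permutes the three signed terms of the relator
  cyclically.
\<close>

section \<open>Signs in presented operads\<close>

declare expr_eq.trans [trans]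

lemma deg_signed_expr [simp]: "deg dg (signed_expr e a) = deg dg a"
  by (simp add: signed_expr_def)

lemma wt_signed_expr [simp]: "wt wg (signed_expr e a) = wt wg a"
  by (simp add: signed_expr_def)

lemma wf_signed_expr [simp]: "wf_expr dg wg (signed_expr e a) \<longleftrightarrow> wf_expr dg wg a"
  by (simp add: signed_expr_def)

lemma signed_expr_parity: "even e \<longleftrightarrow> even f \<Longrightarrow> signed_expr e a = signed_expr f a"
  by (simp add: signed_expr_def)

lemma expr_eq_signed:
  "expr_eq dg wg R a b \<Longrightarrow> expr_eq dg wg R (signed_expr e a) (signed_expr e b)"
  by (simp add: signed_expr_def expr_eq.neg_cong)

text \<open>The congruence has no rule for double negation. Equality of classes is the congruence,
  so the identity is inherited from the abelian group of classes; the next lemma is obtained in the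
  same way.\<close>

lemma expr_eq_neg_neg:
  assumes "wf_expr dg wg a"
  shows "expr_eq dg wg R (Neg (Neg a)) a"
proof -
  let ?G = "piece (presented_operad dg wg R) (deg dg a) (wt wg a)"
  interpret comm_group ?G using assms deg_pos by (intro comm_group_presented) auto
  have "inv\<^bsub>?G\<^esub> (inv\<^bsub>?G\<^esub> (expr_class dg wg R a)) = expr_class dg wg R a"
    using assms by (intro inv_inv) (auto simp: carrier_presented)
  then show ?thesis using assms by (simp add: inv_presented expr_class_eq_iff)
qed

lemma expr_eq_neg_add:
  assumes "wf_expr dg wg (Add a b)"
  shows "expr_eq dg wg R (Neg (Add a b)) (Add (Neg a) (Neg b))"
proof -
  let ?G = "piece (presented_operad dg wg R) (deg dg a) (wt wg a)"
  interpret comm_group ?G using assms deg_pos by (intro comm_group_presented) auto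
  have "inv\<^bsub>?G\<^esub> (expr_class dg wg R a \<otimes>\<^bsub>?G\<^esub> expr_class dg wg R b) =
      inv\<^bsub>?G\<^esub> (expr_class dg wg R a) \<otimes>\<^bsub>?G\<^esub> inv\<^bsub>?G\<^esub> (expr_class dg wg R b)"
    using assms by (intro inv_mult) (auto simp: carrier_presented)
  then show ?thesis using assms by (simp add: inv_presented mult_presented expr_class_eq_iff)
qed

lemma expr_eq_signed_add:
  assumes "wf_expr dg wg (Add a b)"
  shows "expr_eq dg wg R (signed_expr e (Add a b)) (Add (signed_expr e a) (signed_expr e b))"
  using expr_eq_neg_add[OF assms] expr_eq.refl[OF assms] by (simp add: signed_expr_def)

lemma expr_eq_signed_signed:
  assumes "wf_expr dg wg a"
  shows "expr_eq dg wg R (signed_expr e (signed_expr f a)) (signed_expr (e + f) a)"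
  using assms expr_eq_neg_neg[OF assms] by (auto simp: signed_expr_def intro: expr_eq.refl)

text \<open>The congruence imposes only additivity of composition in each argument. Composing with a
  fixed class is therefore a group homomorphism, and these commute with inverses.\<close>

lemma expr_eq_circ_neg_left:
  assumes "wf_expr dg wg (Circ a i b)"
  shows "expr_eq dg wg R (Circ (Neg a) i b) (Neg (Circ a i b))"
proof -
  let ?P = "presented_operad dg wg R"
  let ?G = "piece ?P (deg dg a) (wt wg a)"
  let ?H = "piece ?P (deg dg a + deg dg b - 1) (wt wg a + wt wg b)"
  interpret operad ?P by (rule operad_presented)
  have pos: "deg dg a \<ge> 1" "deg dg b \<ge> 1" using assms deg_pos[of dg wg] by auto
  have "group ?G" "group ?H"
    using pos piece_comm_group unfolding comm_group_def by simp_all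
  moreover have "(\<lambda>x. circ ?P (deg dg a) (wt wg a) (deg dg b) (wt wg b) i x (expr_class dg wg R b))
      \<in> hom ?G ?H"
    using assms pos by (intro circ_hom_left) (auto simp: carrier_presented)
  ultimately interpret group_hom ?G ?H
    "\<lambda>x. circ ?P (deg dg a) (wt wg a) (deg dg b) (wt wg b) i x (expr_class dg wg R b)"
    by (simp add: group_hom_def group_hom_axioms_def)
  have "expr_class dg wg R a \<in> carrier ?G" using assms by (auto simp: carrier_presented)
  from hom_inv[OF this] show ?thesis
    using assms by (simp add: inv_presented circ_presented expr_class_eq_iff)
qed

lemma expr_eq_circ_neg_right:
  assumes "wf_expr dg wg (Circ a i b)"
  shows "expr_eq dg wg R (Circ a i (Neg b)) (Neg (Circ a i b))"
proof -
  let ?P = "presented_operad dg wg R"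
  let ?G = "piece ?P (deg dg b) (wt wg b)"
  let ?H = "piece ?P (deg dg a + deg dg b - 1) (wt wg a + wt wg b)"
  interpret operad ?P by (rule operad_presented)
  have pos: "deg dg a \<ge> 1" "deg dg b \<ge> 1" using assms deg_pos[of dg wg] by auto
  have "group ?G" "group ?H"
    using pos piece_comm_group unfolding comm_group_def by simp_all
  moreover have "(\<lambda>y. circ ?P (deg dg a) (wt wg a) (deg dg b) (wt wg b) i (expr_class dg wg R a) y)
      \<in> hom ?G ?H"
    using assms pos by (intro circ_hom_right) (auto simp: carrier_presented)
  ultimately interpret group_hom ?G ?H
    "\<lambda>y. circ ?P (deg dg a) (wt wg a) (deg dg b) (wt wg b) i (expr_class dg wg R a) y"
    by (simp add: group_hom_def group_hom_axioms_def)
  have "expr_class dg wg R b \<in> carrier ?G" using assms by (auto simp: carrier_presented)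
  from hom_inv[OF this] show ?thesis
    using assms by (simp add: inv_presented circ_presented expr_class_eq_iff)
qed

lemma expr_eq_circ_signed_left:
  assumes "wf_expr dg wg (Circ a i b)"
  shows "expr_eq dg wg R (Circ (signed_expr e a) i b) (signed_expr e (Circ a i b))"
  using expr_eq_circ_neg_left[OF assms] expr_eq.refl[OF assms] by (simp add: signed_expr_def)

lemma expr_eq_circ_signed_right:
  assumes "wf_expr dg wg (Circ a i b)"
  shows "expr_eq dg wg R (Circ a i (signed_expr e b)) (signed_expr e (Circ a i b))"
  using expr_eq_circ_neg_right[OF assms] expr_eq.refl[OF assms] by (simp add: signed_expr_def)


section \<open>Anticyclic structures on presented operads\<close>

text \<open>The anticyclic axioms read from left to right as a recursion, with \<open>t\<close>
  prescribing the images of generators. The summand \<open>1\<close> in the exponent is the minus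
  sign of the rule for \<open>i = 1\<close>.\<close>

primrec theta_expr :: "('g \<Rightarrow> nat) \<Rightarrow> ('g \<Rightarrow> int) \<Rightarrow> ('g \<Rightarrow> 'g expr) \<Rightarrow> 'g expr \<Rightarrow> 'g expr" where
  "theta_expr dg wg t (Gen g) = t g"
| "theta_expr dg wg t Unit = Neg Unit"
| "theta_expr dg wg t (Zero n k) = Zero n k"
| "theta_expr dg wg t (Neg a) = Neg (theta_expr dg wg t a)"
| "theta_expr dg wg t (Add a b) = Add (theta_expr dg wg t a) (theta_expr dg wg t b)"
| "theta_expr dg wg t (Circ a i b) =
    (if i > 1 then Circ (theta_expr dg wg t a) (i - 1) b
     else signed_expr (wt wg a * wt wg b + 1)
       (Circ (theta_expr dg wg t b) (deg dg b) (theta_expr dg wg t a)))"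

lemma theta_expr_signed:
  "theta_expr dg wg t (signed_expr e a) = signed_expr e (theta_expr dg wg t a)"
  by (simp add: signed_expr_def)

text \<open>Conditions on generators and relators which make the recursion descend to an anticyclic
  structure. The guard \<open>dg g \<ge> 1\<close> singles out the generators that are well-formed
  expressions.\<close>

locale anticyclic_presentation =
  fixes dg :: "'g \<Rightarrow> nat" and wg :: "'g \<Rightarrow> int" and R :: "'g expr set" and t :: "'g \<Rightarrow> 'g expr"
  assumes t_wf: "dg g \<ge> 1 \<Longrightarrow> wf_expr dg wg (t g)"
    and t_deg: "dg g \<ge> 1 \<Longrightarrow> deg dg (t g) = dg g"
    and t_wt: "dg g \<ge> 1 \<Longrightarrow> wt wg (t g) = wg g"
    and t_relator: "\<lbrakk>r \<in> R; wf_expr dg wg r\<rbrakk> \<Longrightarrow>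
      expr_eq dg wg R (theta_expr dg wg t r) (Zero (deg dg r) (wt wg r))"
    and t_order: "dg g \<ge> 1 \<Longrightarrow>
      expr_eq dg wg R ((theta_expr dg wg t ^^ (dg g + 1)) (Gen g)) (Gen g)"
begin

abbreviation T where "T \<equiv> theta_expr dg wg t"
abbreviation W where "W \<equiv> wf_expr dg wg"
abbreviation D where "D \<equiv> deg dg"
abbreviation K where "K \<equiv> wt wg"
abbreviation E (infix "\<approx>" 50) where "a \<approx> b \<equiv> expr_eq dg wg R a b"
abbreviation cls where "cls \<equiv> expr_class dg wg R"
abbreviation Q where "Q \<equiv> presented_operad dg wg R"

section \<open>Compatibility of the formal operator with the operad axioms\<close>

lemma theta_expr_wf: "W a \<Longrightarrow> W (T a) \<and> D (T a) = D a \<and> K (T a) = K a"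
proof (induction a)
  case (Circ a i b)
  then show ?case using deg_pos[of dg wg b] by auto
qed (auto simp: t_wf t_deg t_wt)

lemma W_pos: "W a \<Longrightarrow> D a \<ge> 1"
  by (rule deg_pos)

text \<open>The Koszul exponents below agree only modulo 2; this reduces each comparison of signs to
  a parity check on weights.\<close>

lemma signed_combine:
  assumes "W a" "even (e + f) \<longleftrightarrow> even h"
  shows "signed_expr e (signed_expr f a) \<approx> signed_expr h a"
  using expr_eq_signed_signed[OF assms(1), of R e f] signed_expr_parity[OF assms(2)] by metis

lemma theta_sequential:
  assumes "W (Circ a i b)" "W (Circ b j c)"
  shows "T (Circ (Circ a i b) (j + i - 1) c) \<approx> T (Circ a i (Circ b j c))"
proof -
  have w: "W a" "W b" "W c" using assms by auto
  have pos: "D a \<ge> 1" "D b \<ge> 1" "D c \<ge> 1" and ij: "1 \<le> i" "i \<le> D a" "1 \<le> j" "j \<le> D b"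
    using assms w W_pos by auto
  have th: "W (T a)" "W (T b)" "W (T c)" "D (T a) = D a" "D (T b) = D b" "D (T c) = D c"
    "K (T a) = K a" "K (T b) = K b" "K (T c) = K c"
    using theta_expr_wf w by auto
  consider "i > 1" | "i = 1" "j > 1" | "i = 1" "j = 1" using ij by linarith
  then show ?thesis
  proof cases
    case 1
    then have e: "j + i - 1 > 1" "j + i - 1 - 1 = j + (i - 1) - 1" using ij by auto
    have "Circ (Circ (T a) (i - 1) b) (j + (i - 1) - 1) c \<approx> Circ (T a) (i - 1) (Circ b j c)"
      using 1 assms th ij by (intro expr_eq.sequential) auto
    then show ?thesis using 1 e by simp
  next
    case 2
    let ?x = "Circ (Circ (T b) (D b) (T a)) (j - 1) c"
    have wx: "W ?x" using 2 th w pos ij by auto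
    \<comment> \<open>Inserting \<open>c\<close> in slot \<open>j - 1 < D b\<close> of
      \<open>T b\<close> shifts its last slot to \<open>D b + D c - 1\<close>. So \<open>c\<close>
      and \<open>T a\<close> sit in different inputs of \<open>T b\<close>, and exchanging them
      costs the exponent \<open>K c * K a\<close>.\<close>
    have par: "Circ (Circ (T b) (j - 1) c) (D b + D c - 1) (T a) \<approx> signed_expr (K c * K a) ?x"
      using expr_eq.parallel[of dg wg "T b" "j - 1" c "D b" "T a" R] 2 th w pos ij by auto
    have "T (Circ (Circ a i b) (j + i - 1) c) = Circ (signed_expr (K a * K b + 1)
        (Circ (T b) (D b) (T a))) (j - 1) c"
      using 2 by simp
    also have "\<dots> \<approx> signed_expr (K a * K b + 1) ?x"
      using wx by (rule expr_eq_circ_signed_left)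
    also have "\<dots> \<approx> signed_expr (K a * (K b + K c) + 1) (signed_expr (K c * K a) ?x)"
      using wx by (intro expr_eq.sym[OF signed_combine]) auto
    also have "\<dots> \<approx> signed_expr (K a * (K b + K c) + 1)
        (Circ (Circ (T b) (j - 1) c) (D b + D c - 1) (T a))"
      by (intro expr_eq_signed expr_eq.sym[OF par])
    also have "\<dots> = T (Circ a i (Circ b j c))" using 2 by simp
    finally show ?thesis .
  next
    case 3
    \<comment> \<open>With both insertions in slot 1 the operator reverses the three factors into a
      chain through last slots. The two bracketings differ by the sequential axiom, and both carry
      the exponent \<open>K a * K b + K a * K c + K b * K c\<close> modulo 2.\<close>
    let ?y = "Circ (Circ (T c) (D c) (T b)) (D b + D c - 1) (T a)"
    let ?x = "Circ (T c) (D c) (Circ (T b) (D b) (T a))"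
    have wx: "W ?x" "W ?y"
      using th pos by auto
    have seq: "?y \<approx> ?x"
      using expr_eq.sequential[of dg wg "T c" "D c" "T b" "D b" "T a" R] th pos by auto
    have "T (Circ (Circ a i b) (j + i - 1) c) = signed_expr ((K a + K b) * K c + 1)
        (Circ (T c) (D c) (signed_expr (K a * K b + 1) (Circ (T b) (D b) (T a))))"
      using 3 by simp
    also have "\<dots> \<approx> signed_expr ((K a + K b) * K c + 1) (signed_expr (K a * K b + 1) ?x)"
      using wx by (intro expr_eq_signed expr_eq_circ_signed_right) auto
    also have "\<dots> \<approx> signed_expr ((K a + K b) * K c + 1) (signed_expr (K a * K b + 1) ?y)"
      by (intro expr_eq_signed expr_eq.sym[OF seq])
    also have "\<dots> \<approx> signed_expr (K a * (K b + K c) + 1 + (K b * K c + 1)) ?y"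
      using wx by (intro signed_combine) auto
    also have "\<dots> \<approx> signed_expr (K a * (K b + K c) + 1) (signed_expr (K b * K c + 1) ?y)"
      using wx by (intro expr_eq.sym[OF signed_combine]) auto
    also have "\<dots> \<approx> signed_expr (K a * (K b + K c) + 1)
        (Circ (signed_expr (K b * K c + 1) (Circ (T c) (D c) (T b))) (D b + D c - 1) (T a))"
      using wx by (intro expr_eq_signed expr_eq.sym[OF expr_eq_circ_signed_left]) auto
    also have "\<dots> = T (Circ a i (Circ b j c))" using 3 by simp
    finally show ?thesis .
  qed
qed

lemma theta_parallel:
  assumes "W (Circ a i b)" "W (Circ a j c)" "i < j"
  shows "T (Circ (Circ a i b) (j + D b - 1) c)
    \<approx> T (signed_expr (K b * K c) (Circ (Circ a j c) i b))"
proof -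
  have w: "W a" "W b" "W c" using assms by auto
  have pos: "D a \<ge> 1" "D b \<ge> 1" "D c \<ge> 1" and ij: "1 \<le> i" "i \<le> D a" "1 < j" "j \<le> D a"
    using assms w W_pos by auto
  have th: "W (T a)" "W (T b)" "W (T c)" "D (T a) = D a" "D (T b) = D b" "D (T c) = D c"
    "K (T a) = K a" "K (T b) = K b" "K (T c) = K c"
    using theta_expr_wf w by auto
  have jb: "j + D b - 1 > 1" using pos ij by linarith
  consider "i > 1" | "i = 1" using ij by linarith
  then show ?thesis
  proof cases
    case 1
    have e: "j + D b - 1 - 1 = (j - 1) + D b - 1" using pos ij by auto
    have "Circ (Circ (T a) (i - 1) b) ((j - 1) + D b - 1) c
        \<approx> signed_expr (K b * K c) (Circ (Circ (T a) (j - 1) c) (i - 1) b)"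
      using 1 assms th ij by (intro expr_eq.parallel) auto
    then show ?thesis using 1 e jb ij by (simp add: theta_expr_signed)
  next
    case 2
    \<comment> \<open>Slot \<open>j\<close> of \<open>a\<close> becomes slot \<open>j - 1\<close> of
      \<open>T a\<close>, which is itself grafted on the last slot of \<open>T b\<close>. Hence
      \<open>c\<close> enters a nested factor, and the sequential axiom applies.\<close>
    let ?y = "Circ (Circ (T b) (D b) (T a)) ((j - 1) + D b - 1) c"
    let ?x = "Circ (T b) (D b) (Circ (T a) (j - 1) c)"
    have e: "j + D b - 1 - 1 = (j - 1) + D b - 1" using pos ij by auto
    have wx: "W ?x" "W ?y" using th pos ij w by auto
    have seq: "?y \<approx> ?x" using th pos ij w by (intro expr_eq.sequential) auto
    have "T (Circ (Circ a i b) (j + D b - 1) c) = Circ (T (Circ a i b)) (j + D b - 1 - 1) c"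
      using jb by simp
    also have "\<dots> =
        Circ (signed_expr (K a * K b + 1) (Circ (T b) (D b) (T a))) ((j - 1) + D b - 1) c"
      unfolding e using 2 by simp
    also have "\<dots> \<approx> signed_expr (K a * K b + 1) ?y"
      using wx by (intro expr_eq_circ_signed_left)
    also have "\<dots> \<approx> signed_expr (K a * K b + 1) ?x"
      by (rule expr_eq_signed[OF seq])
    \<comment> \<open>The sign of the parallel axiom is absorbed, since \<open>K b * K c\<close>
      occurs twice in the total exponent.\<close>
    also have "\<dots> \<approx> signed_expr (K b * K c) (signed_expr ((K a + K c) * K b + 1) ?x)"
      using wx by (intro expr_eq.sym[OF signed_combine]) auto
    also have "\<dots> = T (signed_expr (K b * K c) (Circ (Circ a j c) i b))"
      using 2 ij by (simp add: theta_expr_signed)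
    finally show ?thesis .
  qed
qed

text \<open>This lets \<open>T\<close> act on classes. In the induction on derivations, the exchange
  of factors for \<open>i = 1\<close> turns the left rules for composition into the right ones and
  conversely.\<close>

lemma theta_expr_cong: "a \<approx> b \<Longrightarrow> T a \<approx> T b"
proof (induction rule: expr_eq.induct)
  case (refl a)
  then show ?case using theta_expr_wf by (auto intro: expr_eq.refl)
next
  case (sym a b)
  then show ?case by (auto intro: expr_eq.sym)
next
  case (trans a b c)
  then show ?case by (auto intro: expr_eq.trans)
next
  case (neg_cong a a')
  then show ?case by (auto intro: expr_eq.neg_cong)
next
  case (add_cong a a' b b')
  then show ?case using theta_expr_wf[of a] theta_expr_wf[of b] by (auto intro: expr_eq.add_cong)
next
  case (circ_cong a a' b b' i)
  \<comment> \<open>The rule for \<open>i = 1\<close> also involves the weights of both factors and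
    the degree of \<open>b\<close>, which the congruence preserves.\<close>
  have w: "W a" "W b" "K a' = K a" "D a' = D a" "K b' = K b" "D b' = D b"
    using expr_eq_wf circ_cong.hyps by metis+
  show ?case
  proof (cases "i > 1")
    case True
    then show ?thesis using circ_cong theta_expr_wf[of a] w by (auto intro!: expr_eq.circ_cong)
  next
    case False
    then show ?thesis
      using circ_cong theta_expr_wf[of a] theta_expr_wf[of b] w W_pos[of b]
      by (auto intro!: expr_eq.circ_cong expr_eq_signed)
  qed
next
  case (add_assoc a b c)
  then show ?case
    using theta_expr_wf[of a] theta_expr_wf[of b] theta_expr_wf[of c]
    by (auto intro: expr_eq.add_assoc)
next
  case (add_comm a b)
  then show ?case
    using theta_expr_wf[of a] theta_expr_wf[of b] by (auto intro: expr_eq.add_comm)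
next
  case (add_zero a)
  then show ?case using theta_expr_wf[of a] expr_eq.add_zero[of dg wg "T a" R] by simp
next
  case (add_neg a)
  then show ?case using theta_expr_wf[of a] expr_eq.add_neg[of dg wg "T a" R] by simp
next
  case (circ_add_left a a' i b)
  then have w: "W (T a)" "W (T a')" "W (T b)" "W b" "D (T a) = D a" "D (T a') = D a" "D (T b) = D b"
    "K (T a) = K a" "K (T a') = K a" "K a' = K a" "D b \<ge> 1" "1 \<le> i" "i \<le> D a"
    using theta_expr_wf[of a] theta_expr_wf[of a'] theta_expr_wf[of b] W_pos[of b] by auto
  show ?case
  proof (cases "i > 1")
    case True
    then show ?thesis using w by (auto intro!: expr_eq.circ_add_left)
  next
    case False
    let ?e = "K a * K b + 1"
    have "signed_expr ?e (Circ (T b) (D b) (Add (T a) (T a')))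
        \<approx> signed_expr ?e (Add (Circ (T b) (D b) (T a)) (Circ (T b) (D b) (T a')))"
      using w by (intro expr_eq_signed expr_eq.circ_add_right) auto
    also have "\<dots> \<approx> Add (signed_expr ?e (Circ (T b) (D b) (T a)))
        (signed_expr ?e (Circ (T b) (D b) (T a')))"
      using w by (intro expr_eq_signed_add) auto
    finally show ?thesis using False w by simp
  qed
next
  case (circ_add_right b b' a i)
  then have w: "W (T b)" "W (T b')" "W (T a)" "W b" "W b'" "D (T a) = D a" "D (T b) = D b"
    "D (T b') = D b" "D b' = D b" "K b' = K b"
    "K (T b) = K b" "K (T b') = K b" "D b \<ge> 1" "1 \<le> i" "i \<le> D a"
    using theta_expr_wf[of a] theta_expr_wf[of b'] theta_expr_wf[of b] W_pos[of b] by auto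
  show ?case
  proof (cases "i > 1")
    case True
    then show ?thesis using w by (auto intro!: expr_eq.circ_add_right)
  next
    case False
    let ?e = "K a * K b + 1"
    have "signed_expr ?e (Circ (Add (T b) (T b')) (D b) (T a))
        \<approx> signed_expr ?e (Add (Circ (T b) (D b) (T a)) (Circ (T b') (D b) (T a)))"
      using w by (intro expr_eq_signed expr_eq.circ_add_left) auto
    also have "\<dots> \<approx> Add (signed_expr ?e (Circ (T b) (D b) (T a)))
        (signed_expr ?e (Circ (T b') (D b) (T a)))"
      using w by (intro expr_eq_signed_add) auto
    finally show ?thesis using False w by simp
  qed
next
  case (unit_right a i)
  then have w: "W (T a)" "D (T a) = D a" "1 \<le> i" "i \<le> D a" using theta_expr_wf[of a] by auto
  show ?case
  proof (cases "i > 1")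
    case True
    then show ?thesis using w by (auto intro!: expr_eq.unit_right)
  next
    case False
    \<comment> \<open>\<open>Unit\<close> has weight zero, so the rule contributes one minus sign,
      which cancels the one in the image of \<open>Unit\<close>. The exchange moves the unit to the
      left factor.\<close>
    have "Neg (Circ (Neg Unit) 1 (T a)) \<approx> Neg (Neg (Circ Unit 1 (T a)))"
      using w by (intro expr_eq.neg_cong expr_eq_circ_neg_left) auto
    also have "\<dots> \<approx> Circ Unit 1 (T a)" using w by (intro expr_eq_neg_neg) auto
    also have "\<dots> \<approx> T a" using w by (intro expr_eq.unit_left)
    finally show ?thesis using False by (simp add: signed_expr_def)
  qed
next
  case (unit_left b)
  then have w: "W (T b)" "D (T b) = D b" "D b \<ge> 1" using theta_expr_wf[of b] W_pos by auto
  have "Neg (Circ (T b) (D b) (Neg Unit)) \<approx> Neg (Neg (Circ (T b) (D b) Unit))"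
    using w by (intro expr_eq.neg_cong expr_eq_circ_neg_right) auto
  also have "\<dots> \<approx> Circ (T b) (D b) Unit" using w by (intro expr_eq_neg_neg) auto
  also have "\<dots> \<approx> T b" using w by (intro expr_eq.unit_right) auto
  finally show ?case by (simp add: signed_expr_def)
next
  case (sequential a i b j c)
  then show ?case by (rule theta_sequential)
next
  case (parallel a i b j c)
  then show ?case by (rule theta_parallel)
next
  case (relator r)
  then show ?case using t_relator by simp
qed

section \<open>Order of the operator on expressions\<close>

lemma theta_pow_wf: "W a \<Longrightarrow> W ((T ^^ r) a) \<and> D ((T ^^ r) a) = D a \<and> K ((T ^^ r) a) = K a"
  by (induction r) (auto simp: theta_expr_wf)

lemma theta_pow_cong: "a \<approx> b \<Longrightarrow> (T ^^ r) a \<approx> (T ^^ r) b"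
  by (induction r) (auto simp: theta_expr_cong)

text \<open>Only the branch \<open>i > 1\<close> of the recursion is met in these powers, so this is
  an equality of expressions and not merely a congruence.\<close>

lemma theta_pow_circ: "r < i \<Longrightarrow> (T ^^ r) (Circ a i b) = Circ ((T ^^ r) a) (i - r) b"
  by (induction r) auto

lemma theta_pow_simps:
  "(T ^^ r) (Zero n k) = Zero n k"
  "(T ^^ r) (Neg a) = Neg ((T ^^ r) a)"
  "(T ^^ r) (Add a b) = Add ((T ^^ r) a) ((T ^^ r) b)"
  "(T ^^ r) (signed_expr e a) = signed_expr e ((T ^^ r) a)"
  by (induction r) (auto simp: theta_expr_signed)

text \<open>One step exchanges the factors and puts \<open>T a\<close> in the last slot of
  \<open>T b\<close>, then \<open>D b - 1\<close> steps slide it to slot 1, and a final step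
  exchanges back. So \<open>b\<close> is hit \<open>D b + 1\<close> times and \<open>a\<close>
  twice.\<close>

lemma theta_pow_circ_1:
  assumes "W (Circ a 1 b)"
  shows "(T ^^ (D b + 1)) (Circ a 1 b) \<approx> Circ (T (T a)) (D a) ((T ^^ (D b + 1)) b)"
proof -
  have w: "W a" "W b" "D b \<ge> 1" using assms W_pos by auto
  have D: "D b = Suc (D b - 1)" using w by simp
  let ?x = "Circ (T (T a)) (D a) ((T ^^ (D b + 1)) b)"
  have th: "W (T a)" "D (T a) = D a" "K (T a) = K a" "W (T (T a))" "D (T (T a)) = D a"
    using theta_expr_wf w by auto
  have thb: "(T ^^ (D b - 1)) (T b) = (T ^^ D b) b" "T ((T ^^ D b) b) = (T ^^ (D b + 1)) b"
    by (subst (2) D, simp only: funpow_Suc_right comp_apply, simp)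
  have "(T ^^ (D b + 1)) (Circ a 1 b) = T ((T ^^ (D b - 1)) (T (Circ a 1 b)))"
    by (subst D, simp only: add_Suc_shift add.right_neutral One_nat_def funpow.simps(2)
        funpow_Suc_right comp_apply) (simp add: funpow_swap1)
  also have "\<dots> = T ((T ^^ (D b - 1))
      (signed_expr (K a * K b + 1) (Circ (T b) (D b) (T a))))"
    by simp
  also have "\<dots> = T (signed_expr (K a * K b + 1) (Circ ((T ^^ D b) b) 1 (T a)))"
    using w by (simp add: theta_pow_simps theta_pow_circ thb[simplified])
  \<comment> \<open>This is the second exchange; its sign equals that of the first, so the two
    cancel.\<close>
  also have "\<dots> = signed_expr (K a * K b + 1) (signed_expr (K b * K a + 1) ?x)"
    using theta_pow_wf[of b "D b"] w th by (simp add: theta_expr_signed)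
  also have "\<dots> \<approx> signed_expr 0 ?x"
    using th theta_pow_wf[of b "D b + 1"] w W_pos[of a] by (intro signed_combine) auto
  also have "signed_expr 0 ?x = ?x" by (simp add: signed_expr_def)
  finally show ?thesis .
qed

lemma theta_expr_order: "W a \<Longrightarrow> (T ^^ (D a + 1)) a \<approx> a"
proof (induction a)
  case (Gen g)
  then show ?case using t_order by simp
next
  case Unit
  then show ?case using expr_eq_neg_neg[of dg wg Unit R] by simp
next
  case (Zero n k)
  then show ?case unfolding theta_pow_simps by (intro expr_eq.refl)
next
  case (Neg a)
  then show ?case unfolding theta_pow_simps by (intro expr_eq.neg_cong) auto
next
  case (Add a b)
  then show ?case
    using theta_pow_wf[of a "D a + 1"] theta_pow_wf[of b "D b + 1"]
    unfolding theta_pow_simps by (intro expr_eq.add_cong) auto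
next
  case (Circ a i b)
  then have w: "W a" "W b" "1 \<le> i" "i \<le> D a" "D b \<ge> 1" using W_pos by auto
  let ?a = "(T ^^ (i - 1)) a"
  have wa: "W ?a" "D ?a = D a" using theta_pow_wf w by auto
  \<comment> \<open>The \<open>D a + D b\<close> steps slide slot \<open>i\<close> down to 1,
    perform the double exchange, which moves the insertion to slot \<open>D a\<close>, and slide it
    from there down to \<open>i\<close>. Thus \<open>a\<close> is hit
    \<open>(i - 1) + 2 + (D a - i) = D a + 1\<close> times.\<close>
  have sum: "D (Circ a i b) + 1 = (D a - i) + ((D b + 1) + (i - 1))" using w by simp
  have "D a + 1 = (D a - i) + (2 + (i - 1))" using w by simp
  then have pow: "(T ^^ (D a + 1)) a = (T ^^ (D a - i)) (T (T ?a))"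
    by (simp only: funpow_add comp_apply) (simp add: numeral_2_eq_2)
  have "(T ^^ (D (Circ a i b) + 1)) (Circ a i b) =
      (T ^^ (D a - i)) ((T ^^ (D b + 1)) ((T ^^ (i - 1)) (Circ a i b)))"
    by (simp only: sum funpow_add comp_apply)
  also have "\<dots> = (T ^^ (D a - i)) ((T ^^ (D b + 1)) (Circ ?a 1 b))"
    using w by (simp add: theta_pow_circ)
  also have "\<dots> \<approx> (T ^^ (D a - i)) (Circ (T (T ?a)) (D a) ((T ^^ (D b + 1)) b))"
    using theta_pow_circ_1[of ?a b] w wa by (intro theta_pow_cong) auto
  also have "\<dots> = Circ ((T ^^ (D a + 1)) a) i ((T ^^ (D b + 1)) b)"
    using w by (subst theta_pow_circ) (auto simp only: pow)
  also have "\<dots> \<approx> Circ a i b"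
    using Circ w theta_pow_wf[of a "D a + 1"] theta_pow_wf[of b "D b + 1"]
    by (intro expr_eq.circ_cong) auto
  finally show ?case .
qed

section \<open>The induced anticyclic structure on the quotient\<close>

definition theta :: "nat \<Rightarrow> int \<Rightarrow> 'g expr set \<Rightarrow> 'g expr set" where
  "theta n k X = (\<Union>a\<in>X. cls (T a))"

text \<open>All members of the class contribute the same set to the union defining
  \<open>theta\<close>, because \<open>T\<close> respects the congruence.\<close>

lemma theta_class:
  assumes "W a"
  shows "theta n k (cls a) = cls (T a)"
proof -
  have "cls (T b) = cls (T a)" if "b \<in> cls a" for b
    using that expr_class_eqI[OF theta_expr_cong] unfolding in_expr_class by blast
  then show ?thesis unfolding theta_def using self_in_expr_class[OF assms] by blast
qed

lemma theta_pow_class: "W a \<Longrightarrow> (theta n k ^^ r) (cls a) = cls ((T ^^ r) a)"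
  by (induction r) (auto simp: theta_class theta_pow_wf)

theorem anticyclic_theta: "anticyclic_operad Q theta"
proof (intro anticyclic_operad.intro anticyclic_operad_axioms.intro operad_presented)
  show "theta n k \<in> hom (piece Q n k) (piece Q n k)" for n k
    using theta_expr_wf
    by (auto simp: hom_def carrier_presented theta_class mult_presented)
  show "theta 1 0 (op_unit Q) = inv\<^bsub>piece Q 1 0\<^esub> (op_unit Q)"
    by (simp add: unit_presented theta_class inv_presented)
  show "(theta n k ^^ (n + 1)) X = X" if X: "X \<in> carrier (piece Q n k)" for n k X
  proof -
    obtain a where "X = cls a" "W a" "D a = n" using X unfolding carrier_presented by auto
    then show ?thesis
      using expr_class_eqI[OF theta_expr_order[of a]] by (simp only: theta_pow_class)
  qed
  show "theta (m + n - 1) (k + l) (circ Q m k n l i X Y) = circ Q m k n l (i - 1) (theta m k X) Y"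
    if i: "i \<in> {1..m}" "i > 1" and XY: "X \<in> carrier (piece Q m k)" "Y \<in> carrier (piece Q n l)"
    for m n i k l X Y
  proof -
    obtain a b where ab: "X = cls a" "W a" "D a = m" "Y = cls b" "W b"
      using XY unfolding carrier_presented by auto
    have "W (Circ a i b)" "W (Circ (T a) (i - 1) b)" using ab i theta_expr_wf[of a] by auto
    then show ?thesis using ab i by (simp add: circ_presented theta_class del: wf_expr.simps)
  qed
  show "theta (m + n - 1) (k + l) (circ Q m k n l 1 X Y) =
      inv\<^bsub>piece Q (m + n - 1) (k + l)\<^esub> (signed (piece Q (m + n - 1) (k + l)) (k * l)
        (circ Q n l m k n (theta n l Y) (theta m k X)))"
    if mn: "m \<ge> 1" "n \<ge> 1" and XY: "X \<in> carrier (piece Q m k)" "Y \<in> carrier (piece Q n l)"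
    for m n k l X Y
  proof -
    obtain a b where ab: "X = cls a" "W a" "D a = m" "K a = k" "Y = cls b" "W b" "D b = n" "K b = l"
      using XY unfolding carrier_presented by auto
    let ?x = "Circ (T b) n (T a)"
    have x: "W ?x" "D ?x = m + n - 1" "K ?x = k + l" using ab mn theta_expr_wf by auto
    have "theta (m + n - 1) (k + l) (circ Q m k n l 1 X Y) = cls (signed_expr (k * l + 1) ?x)"
      using ab mn by (simp add: circ_presented theta_class)
    \<comment> \<open>The minus sign folded into the exponent in \<open>theta_expr\<close> is split
      off again to match the form of the axiom.\<close>
    also have "\<dots> = cls (Neg (signed_expr (k * l) ?x))"
    proof (rule expr_class_eqI[symmetric])
      have "signed_expr 1 (signed_expr (k * l) ?x) \<approx> signed_expr (k * l + 1) ?x"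
        using x(1) by (rule signed_combine) simp
      then show "Neg (signed_expr (k * l) ?x) \<approx> signed_expr (k * l + 1) ?x"
        by (simp only: signed_expr_def[of 1] odd_one if_False)
    qed
    also have "\<dots> = inv\<^bsub>piece Q (m + n - 1) (k + l)\<^esub>
        (signed (piece Q (m + n - 1) (k + l)) (k * l) (cls ?x))"
      using x by (simp only: signed_presented inv_presented wf_signed_expr deg_signed_expr
          wt_signed_expr)
    also have "cls ?x = circ Q n l m k n (theta n l Y) (theta m k X)"
      using ab x by (simp only: circ_presented theta_class)
    finally show ?thesis .
  qed
qed

end

section \<open>Uniqueness given the values on generators\<close>

lemma anticyclic_presented_unique:
  assumes 1: "anticyclic_operad (presented_operad dg wg R) \<theta>"
    and 2: "anticyclic_operad (presented_operad dg wg R) \<theta>'"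
    and gen: "\<And>g. dg g \<ge> 1 \<Longrightarrow> \<theta>' (dg g) (wg g) (expr_class dg wg R (Gen g)) =
      \<theta> (dg g) (wg g) (expr_class dg wg R (Gen g))"
    and n: "n \<ge> 1" and X: "X \<in> carrier (piece (presented_operad dg wg R) n k)"
  shows "\<theta>' n k X = \<theta> n k X"
proof -
  let ?P = "presented_operad dg wg R"
  let ?c = "expr_class dg wg R"
  interpret A: anticyclic_operad ?P \<theta> by (rule 1)
  interpret B: anticyclic_operad ?P \<theta>' by (rule 2)
  have hom: "group_hom (piece ?P n k) (piece ?P n k) (\<theta> n k)"
    "group_hom (piece ?P n k) (piece ?P n k) (\<theta>' n k)" if "n \<ge> 1" for n k
    using that A.theta_hom B.theta_hom A.piece_comm_group
    unfolding group_hom_def group_hom_axioms_def comm_group_def by blast+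
  \<comment> \<open>Every class is represented by an expression, so induction on expressions
    suffices: additivity handles the group operations, and the two composition rules express the
    value on a composite through its factors.\<close>
  have "\<theta>' (deg dg a) (wt wg a) (?c a) = \<theta> (deg dg a) (wt wg a) (?c a)" if "wf_expr dg wg a" for a
    using that
  proof (induction a)
    case (Gen g)
    then show ?case using gen by simp
  next
    case Unit
    show ?case using A.theta_unit B.theta_unit by (simp add: unit_presented)
  next
    case (Zero n k)
    then have "n \<ge> 1" by simp
    note h = hom[OF this, of k]
    from group_hom.hom_one[OF h(1)] group_hom.hom_one[OF h(2)]
    show ?case by (simp add: one_presented)
  next
    case (Neg a)
    let ?n = "deg dg a" and ?k = "wt wg a"
    have "?n \<ge> 1" using Neg deg_pos by simp
    note h = hom[OF this, of ?k]
    have "?c a \<in> carrier (piece ?P ?n ?k)" using Neg by (auto simp: carrier_presented)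
    from group_hom.hom_inv[OF h(1) this] group_hom.hom_inv[OF h(2) this]
    show ?case using Neg by (simp add: inv_presented)
  next
    case (Add a b)
    let ?n = "deg dg a" and ?k = "wt wg a"
    have "?n \<ge> 1" using Add.prems deg_pos[of dg wg a] by simp
    note h = hom[OF this, of ?k]
    have "?c a \<in> carrier (piece ?P ?n ?k)" "?c b \<in> carrier (piece ?P ?n ?k)"
      using Add.prems by (auto simp: carrier_presented)
    from group_hom.hom_mult[OF h(1) this] group_hom.hom_mult[OF h(2) this]
    show ?case using Add by (simp add: mult_presented)
  next
    case (Circ a i b)
    let ?m = "deg dg a" and ?k = "wt wg a" and ?n = "deg dg b" and ?l = "wt wg b"
    have w: "wf_expr dg wg a" "wf_expr dg wg b" "i \<in> {1..?m}" using Circ.prems by auto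
    have pos: "?m \<ge> 1" "?n \<ge> 1" using w deg_pos by auto
    have cl: "?c a \<in> carrier (piece ?P ?m ?k)" "?c b \<in> carrier (piece ?P ?n ?l)"
      using w by (auto simp: carrier_presented)
    have c: "?c (Circ a i b) = circ ?P ?m ?k ?n ?l i (?c a) (?c b)"
      using Circ.prems by (simp add: circ_presented)
    have IH: "\<theta>' ?m ?k (?c a) = \<theta> ?m ?k (?c a)" "\<theta>' ?n ?l (?c b) = \<theta> ?n ?l (?c b)"
      using Circ.IH w by auto
    show ?case
    proof (cases "i = 1")
      case True
      then show ?thesis
        using A.theta_circ_1[OF pos cl] B.theta_circ_1[OF pos cl] IH c by simp
    next
      case False
      then have "i > 1" using w by simp
      then show ?thesis
        using A.theta_circ[OF pos w(3) _ cl] B.theta_circ[OF pos w(3) _ cl] IH c by simp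
    qed
  qed
  then show ?thesis using X unfolding carrier_presented by auto
qed


section \<open>The operad \<open>V\<close>\<close>

text \<open>As \<open>g\<close> has weight 1, the exponent \<open>1 * 1 + 1\<close> is even. Hence g
  o_1 g goes to (-g) o_3 (-g) = g o_3 g, while -(g o_2 g) goes to g o_1 g and g o_3 g goes to -(g
  o_2 g).\<close>

lemma V_theta_relator:
  "expr_eq V_deg V_wt {V_relator} (theta_expr V_deg V_wt (\<lambda>g. Neg (Gen g)) V_relator) (Zero 5 2)"
proof -
  let ?c = "expr_class V_deg V_wt {V_relator}"
  let ?E = "expr_eq V_deg V_wt {V_relator}"
  let ?x = "\<lambda>i. Circ (Gen ()) i (Gen ()) :: unit expr"
  let ?G = "piece (presented_operad V_deg V_wt {V_relator}) 5 2"
  interpret comm_group ?G by (rule comm_group_presented) simp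
  have wf: "wf_expr V_deg V_wt (?x i)" if "i \<in> {1..3}" for i using that by simp
  have neg: "?E (Circ (Neg (Gen ())) i (Gen ())) (Neg (?x i))" if "i \<in> {1..3}" for i
    using wf[OF that] by (rule expr_eq_circ_neg_left)
  have c3: "?c (Circ (Neg (Gen ())) 3 (Neg (Gen ()))) = ?c (?x 3)"
  proof (rule expr_class_eqI)
    have "?E (Circ (Neg (Gen ())) 3 (Neg (Gen ()))) (Neg (Circ (Neg (Gen ())) 3 (Gen ())))"
      by (rule expr_eq_circ_neg_right) simp
    also have "?E \<dots> (Neg (Neg (?x 3)))" by (intro expr_eq.neg_cong neg) simp
    also have "?E \<dots> (?x 3)" by (intro expr_eq_neg_neg) simp
    finally show "?E (Circ (Neg (Gen ())) 3 (Neg (Gen ()))) (?x 3)" .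
  qed
  have c1: "?c (Neg (Circ (Neg (Gen ())) 1 (Gen ()))) = ?c (?x 1)"
  proof (rule expr_class_eqI)
    have "?E (Neg (Circ (Neg (Gen ())) 1 (Gen ()))) (Neg (Neg (?x 1)))"
      by (intro expr_eq.neg_cong neg) simp
    also have "?E \<dots> (?x 1)" by (intro expr_eq_neg_neg) simp
    finally show "?E (Neg (Circ (Neg (Gen ())) 1 (Gen ()))) (?x 1)" .
  qed
  have c2: "?c (Circ (Neg (Gen ())) 2 (Gen ())) = inv\<^bsub>?G\<^esub> ?c (?x 2)"
    using expr_class_eqI[OF neg[of 2]] by (simp add: inv_presented)
  have cl: "?c (?x i) \<in> carrier ?G" if "i \<in> {1..3}" for i
    using that by (auto simp: carrier_presented)
  have "?c (?x 1) \<otimes>\<^bsub>?G\<^esub> inv\<^bsub>?G\<^esub> ?c (?x 2) \<otimes>\<^bsub>?G\<^esub> ?c (?x 3) = \<one>\<^bsub>?G\<^esub>"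
    using V_gen_relation unfolding V_operad_def V_gen_def by (simp add: circ_presented)
  then have "?c (?x 3) \<otimes>\<^bsub>?G\<^esub> ?c (?x 1) \<otimes>\<^bsub>?G\<^esub> inv\<^bsub>?G\<^esub> ?c (?x 2) = \<one>\<^bsub>?G\<^esub>"
    using cl[of 1] cl[of 2] cl[of 3] by (simp add: m_ac)
  then have "?c (Add (Add (Circ (Neg (Gen ())) 3 (Neg (Gen ()))) (Neg (Circ (Neg (Gen ())) 1 (Gen ()))))
      (Circ (Neg (Gen ())) 2 (Gen ()))) = \<one>\<^bsub>?G\<^esub>"
    by (simp add: mult_presented[symmetric, where n=5 and k=2] c1[simplified] c2 c3)
  then show ?thesis
    by (simp add: one_presented expr_class_eq_iff V_relator_def signed_expr_def)
qed

text \<open>Operators are compared only on carriers in degrees \<open>n \<ge> 1\<close>, where the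
  axioms constrain them; \<open>inv\<close> is the negative, as the pieces are written
  multiplicatively.\<close>

theorem proposition2p2:
  "\<exists>\<theta>. anticyclic_operad V_operad \<theta> \<and> \<theta> 3 1 V_gen = inv\<^bsub>piece V_operad 3 1\<^esub> V_gen \<and>
     (\<forall>\<theta>'. anticyclic_operad V_operad \<theta>' \<and> \<theta>' 3 1 V_gen = inv\<^bsub>piece V_operad 3 1\<^esub> V_gen \<longrightarrow>
       (\<forall>n\<ge>1. \<forall>k. \<forall>a\<in>carrier (piece V_operad n k). \<theta>' n k a = \<theta> n k a))"
proof -
  interpret V: anticyclic_presentation V_deg V_wt "{V_relator}" "\<lambda>g. Neg (Gen g)"
  proof
    let ?T = "theta_expr V_deg V_wt (\<lambda>g. Neg (Gen g)) :: unit expr \<Rightarrow> unit expr"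
    let ?E = "expr_eq V_deg V_wt {V_relator}"
    show "?E (?T r) (Zero (deg V_deg r) (wt V_wt r))" if "r \<in> {V_relator}" for r
      using that V_theta_relator by (simp add: V_relator_def)
    \<comment> \<open>In degree 3 the order condition concerns the fourth power of the operator, and
      four changes of sign restore \<open>g\<close>.\<close>
    have "?E (Neg (Neg (Neg (Neg (Gen g))))) (Neg (Neg (Gen g)))" for g
      by (intro expr_eq_neg_neg) simp
    also have "?E (Neg (Neg (Gen g))) (Gen g)" for g
      by (intro expr_eq_neg_neg) simp
    finally show "?E ((?T ^^ (V_deg g + 1)) (Gen g)) (Gen g)" for g
      by (simp add: numeral_eq_Suc)
  qed auto
  have gen: "V.theta 3 1 V_gen = inv\<^bsub>piece V_operad 3 1\<^esub> V_gen"
    unfolding V_gen_def V_operad_def using V.theta_class[of "Gen ()" 3 1] by (simp add: inv_presented)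
  moreover have "\<theta>' n k a = V.theta n k a"
    if "anticyclic_operad V_operad \<theta>'" "\<theta>' 3 1 V_gen = inv\<^bsub>piece V_operad 3 1\<^esub> V_gen"
      "n \<ge> 1" "a \<in> carrier (piece V_operad n k)" for \<theta>' n k a
  proof (rule anticyclic_presented_unique[OF V.anticyclic_theta])
    show "anticyclic_operad V.Q \<theta>'" "n \<ge> 1" "a \<in> carrier (piece V.Q n k)"
      using that unfolding V_operad_def by auto
    show "\<theta>' (V_deg g) (V_wt g) (V.cls (Gen g)) = V.theta (V_deg g) (V_wt g) (V.cls (Gen g))" for g
      using that(2) gen unfolding V_operad_def V_gen_def by simp
  qed
  ultimately show ?thesis
    using V.anticyclic_theta unfolding V_operad_def by blast
qed

end
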